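(* Let $F_\ast : C_\ast \to D_\ast$ be a chain map between finite-dimensional based chain complexes over a field $\mathbb{F}$, let reductions $R^C_\ast,U^C_\ast$ of $C_\ast$ and $R^D_\ast,U^D_\ast$ of $D_\ast$ be given, with homology revealing bases $(U_k^C,\mathcal I_k^C)$ and $(U_k^D,\mathcal I_k^D)$, and let $x=U_k^C[i]$ with $i\in\mathcal I_k^C$. Run the induced-map algorithm described in the context on this input. Then at the end of its for-loop, $y$ is (the coordinate vector, in the basis of $D_k$ given by the columns of $U_k^D$, of) the preferred representative of its homology class with respect to $(U_k^D,\mathcal I_k^D)$; that is, $y$ has non-zero entries only at indices in $\mathcal I_k^D$.
   Context: $\mathbb{F}$ is a field. A based chain complex $C_\ast$ has a fixed ordered basis in each degree (the cells), so boundary maps $\partial_k:C_k\to C_{k-1}$ ($\partial_0=0$, $\partial_k\partial_{k+1}=0$) and chain maps are matrices. $A[j]$ is the $j$-th column and $A[j,i]$ the $(j,i)$ entry of a matrix $A$. The pivot of a non-zero column is the largest index of a non-zero entry in it. Reduction: matrices $R_k,U_k$ with $\partial_k U_k=R_k$, where $U_k$ is invertible upper triangular and the non-zero columns of $R_k$ have pairwise distinct pivots. Let $\mathcal I_k$ be the set of indices $j$ such that column $j$ of $R_k$ is zero and $j$ is not the pivot of any column of $R_{k+1}$. The columns $U_k[j]$, $j\in\mathcal I_k$, are cycles whose classes form a basis of $H_k=\ker\partial_k/\operatorname{im}\partial_{k+1}$; the pair $(U_k,\mathcal I_k)$ is called a homology revealing basis. The preferred representative of a homology class is its representative that is a linear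 combination of the cycles $U_k[j]$, $j\in\mathcal I_k$, only. Induced-map algorithm. Input: $x=U^C_k[i]$ with $i\in\mathcal I^C_k$, the matrices $U^D_k$, $R^D_{k+1}$, the index set $\mathcal I^D_k$, and the matrix $F_k$ in the original bases. Set $y\leftarrow (U_k^D)^{-1}F_kx$, $N\leftarrow\dim D_k$, $\hat\partial^D_{k+1}\leftarrow (U^D_k)^{-1}R^D_{k+1}$. For $j=N,N-1,\dots,1$: if $y[j]\neq 0$ and $j$ is the pivot of some column $c$ of $\hat\partial_{k+1}^D$, replace $y$ by $y-\alpha\,\hat\partial^D_{k+1}[c]$ with $\alpha=y[j]/\hat\partial^D_{k+1}[j,c]$. Return the entries of $y$ indexed by $\mathcal I^D_k$. Vectors $y$ represent elements of $D_k$ in coordinates with respect to the columns of $U^D_k$. *)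

theory Defs
  imports
    Jordan_Normal_Form.VS_Connect
    Jordan_Normal_Form.Gauss_Jordan_Elimination
begin

text \<open>
  A based chain complex over a field is given by the number \<open>n k\<close> of cells in each degree
  \<open>k :: nat\<close> and by the matrices \<open>d k\<close> of the boundary maps.  Degree \<open>-1\<close> is the zero space, so
  \<open>\<partial>\<^sub>0 = 0\<close> is the matrix \<open>d 0\<close> with no rows.  Indices of rows and columns start at 0.
\<close>

definition based_chain_complex :: "(nat \<Rightarrow> nat) \<Rightarrow> (nat \<Rightarrow> 'a::field mat) \<Rightarrow> bool" where
  "based_chain_complex n d \<longleftrightarrow>
     d 0 \<in> carrier_mat 0 (n 0) \<and>
     (\<forall>k. d (Suc k) \<in> carrier_mat (n k) (n (Suc k))) \<and>
     (\<forall>k. d k * d (Suc k) = 0\<^sub>m (dim_row (d k)) (n (Suc k)))"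

definition chain_map ::
  "(nat \<Rightarrow> nat) \<Rightarrow> (nat \<Rightarrow> 'a::field mat) \<Rightarrow> (nat \<Rightarrow> nat) \<Rightarrow> (nat \<Rightarrow> 'a mat) \<Rightarrow> (nat \<Rightarrow> 'a mat) \<Rightarrow> bool"
where
  "chain_map nC dC nD dD F \<longleftrightarrow>
     (\<forall>k. F k \<in> carrier_mat (nD k) (nC k)) \<and>
     (\<forall>k. dD (Suc k) * F (Suc k) = F k * dC (Suc k))"

text \<open>Homology classes are cosets of the boundaries.\<close>

definition cycles :: "(nat \<Rightarrow> nat) \<Rightarrow> (nat \<Rightarrow> 'a::field mat) \<Rightarrow> nat \<Rightarrow> 'a vec set" where
  "cycles n d k = {z \<in> carrier_vec (n k). d k *\<^sub>v z = 0\<^sub>v (dim_row (d k))}"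

definition boundaries :: "(nat \<Rightarrow> nat) \<Rightarrow> (nat \<Rightarrow> 'a::field mat) \<Rightarrow> nat \<Rightarrow> 'a vec set" where
  "boundaries n d k = (\<lambda>c. d (Suc k) *\<^sub>v c) ` carrier_vec (n (Suc k))"

definition homology_class ::
  "(nat \<Rightarrow> nat) \<Rightarrow> (nat \<Rightarrow> 'a::field mat) \<Rightarrow> nat \<Rightarrow> 'a vec \<Rightarrow> 'a vec set" where
  "homology_class n d k z = (\<lambda>b. z + b) ` boundaries n d k"

definition homology :: "(nat \<Rightarrow> nat) \<Rightarrow> (nat \<Rightarrow> 'a::field mat) \<Rightarrow> nat \<Rightarrow> 'a vec set set" where
  "homology n d k = homology_class n d k ` cycles n d k"

text \<open>The value of \<open>pivot\<close> is meaningful for non-zero vectors only.\<close>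

definition pivot :: "'a::zero vec \<Rightarrow> nat" where
  "pivot v = Max {j. j < dim_vec v \<and> v $ j \<noteq> 0}"

definition is_zero_col :: "'a::zero mat \<Rightarrow> nat \<Rightarrow> bool" where
  "is_zero_col A c \<longleftrightarrow> col A c = 0\<^sub>v (dim_row A)"

definition is_pivot_of_col :: "'a::zero mat \<Rightarrow> nat \<Rightarrow> nat \<Rightarrow> bool" where
  "is_pivot_of_col A j c \<longleftrightarrow> c < dim_col A \<and> \<not> is_zero_col A c \<and> pivot (col A c) = j"

definition distinct_pivots :: "'a::zero mat \<Rightarrow> bool" where
  "distinct_pivots A \<longleftrightarrow> inj_on (\<lambda>c. pivot (col A c)) {c. c < dim_col A \<and> \<not> is_zero_col A c}"

definition reduction ::
  "(nat \<Rightarrow> nat) \<Rightarrow> (nat \<Rightarrow> 'a::field mat) \<Rightarrow> (nat \<Rightarrow> 'a mat) \<Rightarrow> (nat \<Rightarrow> 'a mat) \<Rightarrow> bool" where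
  "reduction n d R U \<longleftrightarrow>
     (\<forall>k. U k \<in> carrier_mat (n k) (n k) \<and> invertible_mat (U k) \<and> upper_triangular (U k) \<and>
          d k * U k = R k \<and> distinct_pivots (R k))"

text \<open>
  The index set \<open>\<I>\<^sub>k\<close>; the pair of \<open>U k\<close> and \<open>revealing_indices n R k\<close> is the homology revealing
  basis in degree \<open>k\<close>.
\<close>

definition revealing_indices :: "(nat \<Rightarrow> nat) \<Rightarrow> (nat \<Rightarrow> 'a::zero mat) \<Rightarrow> nat \<Rightarrow> nat set" where
  "revealing_indices n R k =
     {j. j < n k \<and> is_zero_col (R k) j \<and> \<not> (\<exists>c. is_pivot_of_col (R (Suc k)) j c)}"

text \<open>\<open>z\<close> is the one and only element of the class \<open>h\<close> in the span of the columns \<open>U[j]\<close>, \<open>j \<in> I\<close>.\<close>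

definition preferred_representative ::
  "(nat \<Rightarrow> nat) \<Rightarrow> (nat \<Rightarrow> 'a::field mat) \<Rightarrow> nat \<Rightarrow> 'a mat \<Rightarrow> nat set \<Rightarrow> 'a vec set \<Rightarrow> 'a vec \<Rightarrow> bool"
where
  "preferred_representative n d k U I h z \<longleftrightarrow>
     h \<in> homology n d k \<and>
     h \<inter> LinearCombinations.module.span class_ring (module_vec TYPE('a) (n k)) (col U ` I) = {z}"

text \<open>
  One pass through the body of the for-loop, with \<open>H\<close> in the role of the boundary matrix
  \<open>U\<inverse> R\<close>.  When the loop runs on a reduction, the columns of \<open>H\<close> have distinct pivots and the
  choice of \<open>c\<close> is unique.
\<close>

definition loop_step :: "'a::field mat \<Rightarrow> nat \<Rightarrow> 'a vec \<Rightarrow> 'a vec" where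
  "loop_step H j y =
     (if y $ j \<noteq> 0 \<and> (\<exists>c. is_pivot_of_col H j c)
      then let c = (SOME c. is_pivot_of_col H j c); \<alpha> = y $ j / H $$ (j, c)
           in y - \<alpha> \<cdot>\<^sub>v col H c
      else y)"

text \<open>
  The vector \<open>y\<close> at the end of the for-loop, for the input \<open>x\<close>, the matrices \<open>U\<close> and \<open>R\<close> in the roles
  of \<open>U\<^sub>k\<close> and \<open>R\<^sub>k\<^sub>+\<^sub>1\<close> of the target, and the matrix \<open>F\<close> of the map in degree \<open>k\<close>.
  The loop index runs downwards.
\<close>

definition induced_map_loop :: "'a::field mat \<Rightarrow> 'a mat \<Rightarrow> 'a mat \<Rightarrow> 'a vec \<Rightarrow> 'a vec" where
  "induced_map_loop U R F x =
     (let Uinv = the (mat_inverse U);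
          y = Uinv *\<^sub>v (F *\<^sub>v x);
          N = dim_row U;
          H = Uinv * R
      in fold (loop_step H) (rev [0..<N]) y)"

end

theory Submission
  imports Defs
begin

text \<open>
  Write \<open>H = U\<inverse> R\<^sub>k\<^sub>+\<^sub>1\<close> for the boundary matrix in the coordinates given by the columns of
  \<open>U = U\<^sub>k\<close>, with all data taken from the target complex.  An upper triangular matrix with non-zero
  diagonal does not move pivots, so \<open>H\<close> and \<open>R\<^sub>k\<^sub>+\<^sub>1 = U H\<close> have the same pivots, column by column
  (\<open>is_pivot_of_col_upper_triangular_mult\<close>).  Clearing the entry at a pivot leaves the
  entries at larger indices alone, hence the downward loop ends with a vector \<open>y\<close> that vanishes at every pivot of
  \<open>H\<close> and differs from the initial vector by an element of the image of \<open>H\<close>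
  (\<open>fold_loop_step\<close>).

  The second fact means that \<open>U y\<close> is homologous to the cycle \<open>F\<^sub>k x\<close>.  In particular \<open>U y\<close> is a
  cycle, that is, \<open>R\<^sub>k y = 0\<close>.  Since the non-zero columns of \<open>R\<^sub>k\<close> have distinct pivots, they are
  linearly independent, so \<open>y\<close> vanishes at their indices too (\<open>kernel_zero_at_nonzero_col\<close>).  What
  is left of the support of \<open>y\<close> lies in \<open>\<I>\<^sub>k\<close>.

  Another representative of the class in the span of the \<open>U[j]\<close>, \<open>j \<in> \<I>\<^sub>k\<close>, would differ from
  \<open>U y\<close> by \<open>U H w\<close> for some \<open>w\<close>, with \<open>H w\<close> vanishing at all pivots of \<open>H\<close>.  A combination of
  columns with distinct pivots that vanishes at all pivots is zero (\<open>image_zero_at_pivots\<close>), so the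
  representative is unique.
\<close>

section \<open>Pivots\<close>

lemma nonzero_vec_pivot:
  assumes "v \<noteq> 0\<^sub>v (dim_vec v)"
  shows "pivot v < dim_vec v" "v $ pivot v \<noteq> 0"
    "\<And>j. pivot v < j \<Longrightarrow> j < dim_vec v \<Longrightarrow> v $ j = 0"
proof -
  let ?S = "{j. j < dim_vec v \<and> v $ j \<noteq> 0}"
  have fin: "finite ?S" by simp
  have "?S \<noteq> {}" using assms by (auto intro!: eq_vecI)
  then have "Max ?S \<in> ?S" using Max_in[OF fin] by blast
  then show "pivot v < dim_vec v" "v $ pivot v \<noteq> 0" unfolding pivot_def by auto
  fix j assume "pivot v < j" "j < dim_vec v"
  then have "j \<notin> ?S" using Max_ge[OF fin, of j] unfolding pivot_def by linarith
  then show "v $ j = 0" using \<open>j < dim_vec v\<close> by simp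
qed

lemma pivot_eqI:
  assumes "p < dim_vec v" "v $ p \<noteq> 0" "\<And>j. p < j \<Longrightarrow> j < dim_vec v \<Longrightarrow> v $ j = 0"
  shows "pivot v = p"
  unfolding pivot_def using assms by (intro Max_eqI) (auto simp: not_less[symmetric])

lemma is_pivot_of_col_iff:
  "is_pivot_of_col A j c \<longleftrightarrow> c < dim_col A \<and> j < dim_row A \<and> A $$ (j, c) \<noteq> 0 \<and>
     (\<forall>l. j < l \<and> l < dim_row A \<longrightarrow> A $$ (l, c) = 0)" (is "?L \<longleftrightarrow> ?R")
proof
  assume ?L
  then have c: "c < dim_col A" and nz: "col A c \<noteq> 0\<^sub>v (dim_vec (col A c))"
    and p: "pivot (col A c) = j"
    by (auto simp: is_pivot_of_col_def is_zero_col_def)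
  show ?R using nonzero_vec_pivot[OF nz] c unfolding p by auto
next
  assume R: ?R
  have "\<not> is_zero_col A c"
  proof
    assume "is_zero_col A c"
    then have "col A c $ j = 0" using R by (simp add: is_zero_col_def)
    then show False using R by simp
  qed
  moreover have "pivot (col A c) = j" using R by (intro pivot_eqI) auto
  ultimately show ?L using R unfolding is_pivot_of_col_def by auto
qed

lemma nonzero_col_has_pivot:
  assumes "c < dim_col A" "\<not> is_zero_col A c"
  obtains j where "is_pivot_of_col A j c"
  using assms unfolding is_pivot_of_col_def by auto

lemma is_zero_col_iff:
  assumes "c < dim_col A"
  shows "is_zero_col A c \<longleftrightarrow> (\<forall>l < dim_row A. A $$ (l, c) = 0)"
  using assms by (auto simp: is_zero_col_def vec_eq_iff)

lemma distinct_pivots_iff: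
  "distinct_pivots A \<longleftrightarrow>
     (\<forall>p c c'. is_pivot_of_col A p c \<longrightarrow> is_pivot_of_col A p c' \<longrightarrow> c = c')"
  unfolding distinct_pivots_def is_pivot_of_col_def inj_on_def by auto

lemma mult_mat_vec_index:
  assumes "A \<in> carrier_mat nr nc" "v \<in> carrier_vec nc" "p < nr"
  shows "(A *\<^sub>v v) $ p = (\<Sum>l<nc. A $$ (p, l) * v $ l)"
  using assms by (auto simp: scalar_prod_def lessThan_atLeast0 intro!: sum.cong)

lemma mult_unit_vec_eq_col:
  fixes A :: "'a::field mat"
  assumes "A \<in> carrier_mat nr nc" "j < nc"
  shows "A *\<^sub>v unit_vec nc j = col A j"
  using assms by (auto intro!: eq_vecI)

text \<open>
  At the largest among the pivots of the columns that enter a combination there is no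
  cancellation: every other column that enters has a smaller pivot.
\<close>

lemma combination_nonzero_at_pivot:
  fixes A :: "'a::field mat"
  assumes A: "A \<in> carrier_mat nr nc" and dist: "distinct_pivots A" and v: "v \<in> carrier_vec nc"
    and j: "j < nc" "\<not> is_zero_col A j" "v $ j \<noteq> 0"
  obtains p c where "is_pivot_of_col A p c" "(A *\<^sub>v v) $ p \<noteq> 0"
proof -
  define S where "S = {p. \<exists>c. is_pivot_of_col A p c \<and> v $ c \<noteq> 0}"
  have "S \<subseteq> {..<nr}" using A by (auto simp: S_def is_pivot_of_col_iff)
  then have fin: "finite S" by (rule finite_subset) simp
  obtain q where "is_pivot_of_col A q j" using nonzero_col_has_pivot[of j A] j A by auto
  then have "S \<noteq> {}" using j unfolding S_def by blast
  then have "Max S \<in> S" using Max_in[OF fin] by blast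
  then obtain c where c: "is_pivot_of_col A (Max S) c" and vc: "v $ c \<noteq> 0" by (auto simp: S_def)
  let ?p = "Max S"
  have p: "?p < nr" and cn: "c < nc" and Apc: "A $$ (?p, c) \<noteq> 0"
    using c A by (auto simp: is_pivot_of_col_iff)
  have other: "A $$ (?p, l) * v $ l = 0" if l: "l < nc" "l \<noteq> c" for l
  proof (cases "v $ l = 0 \<or> is_zero_col A l")
    case True
    then show ?thesis using l A p by (auto simp: is_zero_col_iff)
  next
    case False
    then obtain q where q: "is_pivot_of_col A q l"
      using nonzero_col_has_pivot[of l A] l A by auto
    then have "q \<in> S" using False by (auto simp: S_def)
    then have "q \<le> ?p" using fin by simp
    moreover have "q \<noteq> ?p" using q c l dist unfolding distinct_pivots_iff by blast
    ultimately have "A $$ (?p, l) = 0" using q p A by (auto simp: is_pivot_of_col_iff)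
    then show ?thesis by simp
  qed
  have "(A *\<^sub>v v) $ ?p = (\<Sum>l<nc. A $$ (?p, l) * v $ l)"
    by (rule mult_mat_vec_index[OF A v p])
  also have "\<dots> = A $$ (?p, c) * v $ c"
    using cn other by (subst sum.remove[of _ c]) (auto intro!: sum.neutral simp del: mult_eq_0_iff)
  finally show ?thesis using that[OF c] Apc vc by auto
qed

lemma kernel_zero_at_nonzero_col:
  fixes A :: "'a::field mat"
  assumes "A \<in> carrier_mat nr nc" "distinct_pivots A" "v \<in> carrier_vec nc"
    and Av: "A *\<^sub>v v = 0\<^sub>v nr" and "j < nc" "\<not> is_zero_col A j"
  shows "v $ j = 0"
proof (rule ccontr)
  assume "v $ j \<noteq> 0"
  then obtain p c where "is_pivot_of_col A p c" "(A *\<^sub>v v) $ p \<noteq> 0"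
    using combination_nonzero_at_pivot assms by metis
  then show False using assms(1) unfolding Av by (auto simp: is_pivot_of_col_iff)
qed

lemma image_zero_at_pivots:
  fixes A :: "'a::field mat"
  assumes A: "A \<in> carrier_mat nr nc" and dist: "distinct_pivots A" and v: "v \<in> carrier_vec nc"
    and zero: "\<And>p c. is_pivot_of_col A p c \<Longrightarrow> (A *\<^sub>v v) $ p = 0"
  shows "A *\<^sub>v v = 0\<^sub>v nr"
proof (rule eq_vecI)
  fix p assume "p < dim_vec (0\<^sub>v nr :: 'a vec)"
  then have p: "p < nr" by simp
  have "A $$ (p, l) * v $ l = 0" if "l < nc" for l
  proof (cases "is_zero_col A l")
    case True
    then show ?thesis using that A p by (auto simp: is_zero_col_iff)
  next
    case False
    then have "v $ l = 0"
      using combination_nonzero_at_pivot[OF A dist v that] zero by metis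
    then show ?thesis by simp
  qed
  then show "(A *\<^sub>v v) $ p = 0\<^sub>v nr $ p"
    using p mult_mat_vec_index[OF A v p] by (simp add: sum.neutral del: mult_eq_0_iff)
qed (use A in auto)

section \<open>Invertible upper triangular matrices\<close>

lemma mat_inverse_of_invertible:
  fixes U :: "'a::field mat"
  assumes U: "U \<in> carrier_mat n n" and inv: "invertible_mat U"
  shows "the (mat_inverse U) \<in> carrier_mat n n" "U * the (mat_inverse U) = 1\<^sub>m n"
    "the (mat_inverse U) * U = 1\<^sub>m n"
proof -
  obtain B where UB: "U * B = 1\<^sub>m (dim_row U)" and BU: "B * U = 1\<^sub>m (dim_row B)"
    using inv unfolding invertible_mat_def inverts_mat_def by auto
  have "dim_col B = n" using arg_cong[OF UB, of dim_col] U by simp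
  moreover have "dim_row B = n" using arg_cong[OF BU, of dim_col] U by simp
  ultimately have "B \<in> carrier_mat n n" by auto
  then have "U \<in> Units (ring_mat TYPE('a) n ())"
    using U UB BU unfolding Units_def ring_mat_def by auto
  then obtain V where "mat_inverse U = Some V" using mat_inverse(1)[OF U] by fastforce
  then show "the (mat_inverse U) \<in> carrier_mat n n" "U * the (mat_inverse U) = 1\<^sub>m n"
    "the (mat_inverse U) * U = 1\<^sub>m n"
    using mat_inverse(2)[OF U] by auto
qed

lemma upper_triangular_invertible_diag:
  fixes U :: "'a::field mat"
  assumes U: "U \<in> carrier_mat n n" and inv: "invertible_mat U" and ut: "upper_triangular U"
    and j: "j < n"
  shows "U $$ (j, j) \<noteq> 0"
proof -
  have "det U * det (the (mat_inverse U)) = 1"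
    using det_mult[OF U mat_inverse_of_invertible(1)[OF U inv]]
      mat_inverse_of_invertible(2)[OF U inv] by simp
  then have "det U \<noteq> 0" by auto
  then have "0 \<notin> set (diag_mat U)" using upper_triangular_imp_det_eq_0_iff[OF U ut] by blast
  then show ?thesis using U j by (auto simp: diag_mat_def)
qed

text \<open>
  Row \<open>p\<close> of an upper triangular \<open>U\<close> only sees the entries from \<open>p\<close> on; at the pivot \<open>p\<close> of a
  column this leaves the single term with the diagonal entry \<open>U $$ (p, p)\<close>, and below it nothing.
\<close>

lemma is_pivot_of_col_upper_triangular_mult:
  fixes U H :: "'a::field mat"
  assumes U: "U \<in> carrier_mat n n" and ut: "upper_triangular U"
    and diag: "\<And>j. j < n \<Longrightarrow> U $$ (j, j) \<noteq> 0" and H: "H \<in> carrier_mat n m"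
  shows "is_pivot_of_col (U * H) p c \<longleftrightarrow> is_pivot_of_col H p c"
proof -
  have entry: "(U * H) $$ (i, c) = (\<Sum>l<n. U $$ (i, l) * H $$ (l, c))" if "i < n" "c < m" for i
    using that U H by (auto simp: scalar_prod_def lessThan_atLeast0 intro!: sum.cong)
  have lower: "U $$ (i, l) = 0" if "l < i" "i < n" for i l
    using that ut U by (auto simp: upper_triangular_def)
  have mult: "is_pivot_of_col (U * H) q c" if q: "is_pivot_of_col H q c" for q
  proof -
    have qn: "q < n" and c: "c < m" and Hqc: "H $$ (q, c) \<noteq> 0"
      and above: "\<And>l. q < l \<Longrightarrow> l < n \<Longrightarrow> H $$ (l, c) = 0"
      using q H by (auto simp: is_pivot_of_col_iff)
    have "(U * H) $$ (q, c) = U $$ (q, q) * H $$ (q, c)"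
    proof -
      have "U $$ (q, l) * H $$ (l, c) = 0" if "l < n" "l \<noteq> q" for l
        using that lower[of l q] above[of l] qn by (cases "l < q") auto
      then show ?thesis
        unfolding entry[OF qn c] using qn
        by (subst sum.remove[of _ q]) (auto intro!: sum.neutral simp del: mult_eq_0_iff)
    qed
    moreover have "(U * H) $$ (i, c) = 0" if i: "q < i" "i < n" for i
    proof -
      have "U $$ (i, l) * H $$ (l, c) = 0" if "l < n" for l
        using that i lower above by (cases "l < i") auto
      then show ?thesis unfolding entry[OF i(2) c] by (simp add: sum.neutral del: mult_eq_0_iff)
    qed
    ultimately show ?thesis
      unfolding is_pivot_of_col_iff using U H qn c Hqc diag by auto
  qed
  show ?thesis
  proof
    assume UH: "is_pivot_of_col (U * H) p c"
    then have c: "c < m" using H by (auto simp: is_pivot_of_col_iff)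
    have "\<not> is_zero_col H c"
    proof
      assume "is_zero_col H c"
      then have "(U * H) $$ (p, c) = 0"
        using UH U H c entry[of p] by (auto simp: is_pivot_of_col_iff is_zero_col_iff)
      then show False using UH by (auto simp: is_pivot_of_col_iff)
    qed
    then obtain q where q: "is_pivot_of_col H q c"
      using nonzero_col_has_pivot[of c H] c H by auto
    moreover have "p = q" using UH mult[OF q] by (auto simp: is_pivot_of_col_def)
    ultimately show "is_pivot_of_col H p c" by simp
  qed (rule mult)
qed

text \<open>
  This turns membership in the span of some basis vectors into a condition on the support of the
  coordinate vector, which is what the uniqueness of the preferred representative needs.
\<close>

lemma span_cols_eq_image_supported:
  fixes U :: "'a::field mat"
  assumes U: "U \<in> carrier_mat n m" and I: "I \<subseteq> {..<m}"
  shows "LinearCombinations.module.span class_ring (module_vec TYPE('a) n) (col U ` I) =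
    {U *\<^sub>v w |w. w \<in> carrier_vec m \<and> (\<forall>j < m. w $ j \<noteq> 0 \<longrightarrow> j \<in> I)}" (is "_ = ?N")
proof -
  interpret vec_space "TYPE('a)" n .
  have cols: "col U ` I \<subseteq> carrier_vec n" using U by auto
  have "submodule class_ring ?N V"
  proof (rule submodule.intro)
    show "module class_ring V" by (rule module_axioms)
    show "?N \<subseteq> carrier V" using U by auto
    show "\<zero>\<^bsub>V\<^esub> \<in> ?N"
      using U by (auto intro!: exI[of _ "0\<^sub>v m"] simp: module_vec_simps)
  next
    fix v v' assume "v \<in> ?N" "v' \<in> ?N"
    then obtain w w' where w: "v = U *\<^sub>v w" "w \<in> carrier_vec m" "\<forall>j<m. w $ j \<noteq> 0 \<longrightarrow> j \<in> I"
      and w': "v' = U *\<^sub>v w'" "w' \<in> carrier_vec m" "\<forall>j<m. w' $ j \<noteq> 0 \<longrightarrow> j \<in> I" by blast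
    show "v \<oplus>\<^bsub>V\<^esub> v' \<in> ?N"
      using w w' mult_add_distrib_mat_vec[OF U w(2) w'(2)]
      by (auto intro!: exI[of _ "w + w'"] simp: module_vec_simps)
  next
    fix a :: 'a and v assume "v \<in> ?N"
    then obtain w where w: "v = U *\<^sub>v w" "w \<in> carrier_vec m" "\<forall>j<m. w $ j \<noteq> 0 \<longrightarrow> j \<in> I"
      by blast
    show "a \<odot>\<^bsub>V\<^esub> v \<in> ?N"
      using w mult_mat_vec[OF U w(2)]
      by (auto intro!: exI[of _ "a \<cdot>\<^sub>v w"] simp: module_vec_simps)
  qed
  moreover have "col U ` I \<subseteq> ?N"
  proof
    fix v assume "v \<in> col U ` I"
    then obtain j where j: "j \<in> I" "v = col U j" by auto
    then have "j < m" using I by auto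
    then have "v = U *\<^sub>v unit_vec m j" using U j mult_unit_vec_eq_col[OF U] by simp
    moreover have "\<forall>l < m. unit_vec m j $ l \<noteq> (0 :: 'a) \<longrightarrow> l \<in> I"
      using j \<open>j < m\<close> by auto
    ultimately show "v \<in> ?N" using unit_vec_carrier[of m j] by blast
  qed
  ultimately have sub: "span (col U ` I) \<subseteq> ?N" by (intro span_is_subset)
  have "U *\<^sub>v w \<in> span (col U ` I)"
    if w: "w \<in> carrier_vec m" "\<forall>j < m. w $ j \<noteq> 0 \<longrightarrow> j \<in> I" for w
  proof -
    have "vec (length (cols U)) (vec_index w) = w" using w U by auto
    moreover have "\<forall>v \<in> set (cols U). dim_vec v = n" using U by (auto simp: cols_def)
    ultimately have "U *\<^sub>v w = lincomb_list (vec_index w) (cols U)"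
      using U lincomb_list_as_mat_mult[of "cols U" "vec_index w"] mat_of_cols_cols[of U] by simp
    moreover have "lincomb_list (vec_index w) (cols U) \<in> span (col U ` I)"
      unfolding lincomb_list_def
    proof (rule sumlist_in_span[OF cols])
      fix v assume "v \<in> set (map (\<lambda>j. w $ j \<cdot>\<^sub>v cols U ! j) [0..<length (cols U)])"
      then obtain j where j: "j < m" "v = w $ j \<cdot>\<^sub>v col U j" using U by auto
      show "v \<in> span (col U ` I)"
      proof (cases "w $ j = 0")
        case True
        then have "v = 0\<^sub>v n" using j U by auto
        then show ?thesis using span_zero by (simp add: module_vec_simps)
      next
        case False
        then have "col U j \<in> span (col U ` I)" using w j span_mem cols by auto
        then show ?thesis using smult_in_span[OF cols] j by simp
      qed
    qed
    ultimately show ?thesis by simp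
  qed
  then show ?thesis using sub by auto
qed

section \<open>The loop\<close>

lemma loop_step:
  fixes H :: "'a::field mat"
  assumes H: "H \<in> carrier_mat n m" and y: "y \<in> carrier_vec n" and j: "j < n"
  shows "\<exists>w \<in> carrier_vec m. loop_step H j y = y + H *\<^sub>v w"
    and "\<And>l. j < l \<Longrightarrow> l < n \<Longrightarrow> loop_step H j y $ l = y $ l"
    and "is_pivot_of_col H j c \<Longrightarrow> loop_step H j y $ j = 0"
proof -
  have "(\<exists>w \<in> carrier_vec m. loop_step H j y = y + H *\<^sub>v w) \<and>
    (\<forall>l. j < l \<and> l < n \<longrightarrow> loop_step H j y $ l = y $ l) \<and>
    (is_pivot_of_col H j c \<longrightarrow> loop_step H j y $ j = 0)"
  proof (cases "y $ j \<noteq> 0 \<and> (\<exists>c. is_pivot_of_col H j c)")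
    case False
    then show ?thesis using H y
      by (auto simp: loop_step_def intro!: bexI[of _ "0\<^sub>v m"])
  next
    case True
    define d where "d = (SOME c. is_pivot_of_col H j c)"
    define a where "a = y $ j / H $$ (j, d)"
    have "is_pivot_of_col H j d" using True someI_ex unfolding d_def by metis
    then have d: "d < m" "H $$ (j, d) \<noteq> 0" "\<forall>l. j < l \<and> l < n \<longrightarrow> H $$ (l, d) = 0"
      using H by (auto simp: is_pivot_of_col_iff)
    have eq: "loop_step H j y = y - a \<cdot>\<^sub>v col H d"
      using True by (simp add: loop_step_def d_def a_def Let_def)
    have "H *\<^sub>v (- a \<cdot>\<^sub>v unit_vec m d) = - a \<cdot>\<^sub>v col H d"
      using mult_mat_vec[OF H, of "unit_vec m d" "- a"] mult_unit_vec_eq_col[OF H d(1)] by simp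
    then have "loop_step H j y = y + H *\<^sub>v (- a \<cdot>\<^sub>v unit_vec m d)"
      unfolding eq using y H d by (auto intro!: eq_vecI)
    moreover have "- a \<cdot>\<^sub>v unit_vec m d \<in> carrier_vec m" by simp
    moreover have "loop_step H j y $ l = y $ l - a * H $$ (l, d)" if "l < n" for l
      unfolding eq using that y H d by auto
    ultimately show ?thesis using d j by (auto simp: a_def)
  qed
  then show "\<exists>w \<in> carrier_vec m. loop_step H j y = y + H *\<^sub>v w"
    "\<And>l. j < l \<Longrightarrow> l < n \<Longrightarrow> loop_step H j y $ l = y $ l"
    "is_pivot_of_col H j c \<Longrightarrow> loop_step H j y $ j = 0"
    by blast+
qed

text \<open>
  Induction on the number \<open>N\<close> of remaining indices; the hypothesis says that the pivots from \<open>N\<close>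
  on are cleared already, and stays true because later passes change only entries at smaller
  indices.
\<close>

lemma fold_loop_step:
  fixes H :: "'a::field mat"
  assumes H: "H \<in> carrier_mat n m" and "y \<in> carrier_vec n" and "N \<le> n"
    and "\<forall>p c. is_pivot_of_col H p c \<longrightarrow> N \<le> p \<longrightarrow> y $ p = 0"
  shows "(\<exists>w \<in> carrier_vec m. fold (loop_step H) (rev [0..<N]) y = y + H *\<^sub>v w) \<and>
    (\<forall>p c. is_pivot_of_col H p c \<longrightarrow> fold (loop_step H) (rev [0..<N]) y $ p = 0)"
  using assms(2-)
proof (induction N arbitrary: y)
  case 0
  then show ?case using H by (auto intro!: bexI[of _ "0\<^sub>v m"])
next
  case (Suc N)
  let ?z = "loop_step H N y"
  have N: "N < n" using Suc.prems by simp
  note step = loop_step[OF H Suc.prems(1) N]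
  obtain w where w: "w \<in> carrier_vec m" "?z = y + H *\<^sub>v w" using step(1) by blast
  have z: "?z \<in> carrier_vec n" using w H Suc.prems by auto
  have cleared: "\<forall>p c. is_pivot_of_col H p c \<longrightarrow> N \<le> p \<longrightarrow> ?z $ p = 0"
  proof (intro allI impI)
    fix p c assume p: "is_pivot_of_col H p c" "N \<le> p"
    show "?z $ p = 0"
    proof (cases "p = N")
      case False
      have "p < n" using p H by (auto simp: is_pivot_of_col_iff)
      then have "?z $ p = y $ p" using step(2) False p by simp
      also have "\<dots> = 0" using Suc.prems(3) p False by (metis not_less_eq_eq le_antisym)
      finally show ?thesis .
    qed (use p step(3) in blast)
  qed
  have "N \<le> n" using N by simp
  note IH = Suc.IH[OF z this cleared]
  then obtain w' where w': "w' \<in> carrier_vec m"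
    "fold (loop_step H) (rev [0..<N]) ?z = ?z + H *\<^sub>v w'" by blast
  have "?z + H *\<^sub>v w' = y + (H *\<^sub>v w + H *\<^sub>v w')"
    unfolding w using w w' H Suc.prems by (intro assoc_add_vec[of _ n]) auto
  also have "H *\<^sub>v w + H *\<^sub>v w' = H *\<^sub>v (w + w')"
    using mult_add_distrib_mat_vec[OF H w(1) w'(1)] by simp
  finally have "\<exists>w \<in> carrier_vec m. fold (loop_step H) (rev [0..<N]) ?z = y + H *\<^sub>v w"
    using w w' by auto
  then show ?case using IH by simp
qed

section \<open>Cycles and homology classes\<close>

lemma boundary_carrier:
  assumes "based_chain_complex n d"
  shows "d k \<in> carrier_mat (dim_row (d k)) (n k)" "d (Suc k) \<in> carrier_mat (n k) (n (Suc k))"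
  using assms unfolding based_chain_complex_def by (cases k; auto)+

lemma boundary_is_cycle:
  assumes cc: "based_chain_complex n d" and b: "b \<in> boundaries n d k"
  shows "b \<in> cycles n d k"
proof -
  obtain c where c: "c \<in> carrier_vec (n (Suc k))" "b = d (Suc k) *\<^sub>v c"
    using b unfolding boundaries_def by auto
  have "d k *\<^sub>v b = (d k * d (Suc k)) *\<^sub>v c"
    using boundary_carrier[OF cc, of k] c by (simp add: assoc_mult_mat_vec)
  also have "\<dots> = 0\<^sub>v (dim_row (d k))"
    using cc c unfolding based_chain_complex_def by auto
  finally show ?thesis
    using c boundary_carrier(2)[OF cc, of k] unfolding cycles_def by auto
qed

lemma cycles_add:
  assumes "based_chain_complex n d" "z \<in> cycles n d k" "z' \<in> cycles n d k"
  shows "z + z' \<in> cycles n d k"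
  using assms mult_add_distrib_mat_vec[OF boundary_carrier(1)[OF assms(1), of k], of z z']
  by (auto simp: cycles_def)

lemma chain_map_cycle:
  assumes C: "based_chain_complex nC dC" and D: "based_chain_complex nD dD"
    and F: "chain_map nC dC nD dD F" and z: "z \<in> cycles nC dC k"
  shows "F k *\<^sub>v z \<in> cycles nD dD k"
proof -
  have Fk: "F j \<in> carrier_mat (nD j) (nC j)" for j using F unfolding chain_map_def by blast
  have zc: "z \<in> carrier_vec (nC k)" and dz: "dC k *\<^sub>v z = 0\<^sub>v (dim_row (dC k))"
    using z unfolding cycles_def by auto
  have "dD k *\<^sub>v (F k *\<^sub>v z) = 0\<^sub>v (dim_row (dD k))"
  proof (cases k)
    case 0
    then show ?thesis using D unfolding based_chain_complex_def by (auto intro!: eq_vecI)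
  next
    case (Suc l)
    have cD: "dD k \<in> carrier_mat (nD l) (nD k)" and cC: "dC k \<in> carrier_mat (nC l) (nC k)"
      using boundary_carrier(2)[OF D, of l] boundary_carrier(2)[OF C, of l] Suc by auto
    have "dD k *\<^sub>v (F k *\<^sub>v z) = (dD k * F k) *\<^sub>v z"
      using assoc_mult_mat_vec[OF cD Fk zc] by simp
    also have "\<dots> = (F l * dC k) *\<^sub>v z" using F Suc unfolding chain_map_def by simp
    also have "\<dots> = F l *\<^sub>v (dC k *\<^sub>v z)" using assoc_mult_mat_vec[OF Fk cC zc] by simp
    also have "\<dots> = 0\<^sub>v (nD l)" using dz cC Fk[of l] by auto
    finally show ?thesis using cD by simp
  qed
  then show ?thesis using Fk[of k] zc unfolding cycles_def by auto
qed

lemma boundaries_add: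
  assumes cc: "based_chain_complex n d" and "b \<in> boundaries n d k" "b' \<in> boundaries n d k"
  shows "b + b' \<in> boundaries n d k"
proof -
  obtain c c' where c: "c \<in> carrier_vec (n (Suc k))" "b = d (Suc k) *\<^sub>v c"
    and c': "c' \<in> carrier_vec (n (Suc k))" "b' = d (Suc k) *\<^sub>v c'"
    using assms unfolding boundaries_def by auto
  have "b + b' = d (Suc k) *\<^sub>v (c + c')"
    using mult_add_distrib_mat_vec[OF boundary_carrier(2)[OF cc] c(1) c'(1)] c c' by simp
  then show ?thesis using c c' unfolding boundaries_def by auto
qed

lemma boundaries_uminus:
  assumes cc: "based_chain_complex n d" and "b \<in> boundaries n d k"
  shows "- b \<in> boundaries n d k"
proof -
  obtain c where c: "c \<in> carrier_vec (n (Suc k))" "b = d (Suc k) *\<^sub>v c"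
    using assms unfolding boundaries_def by auto
  have "- b = d (Suc k) *\<^sub>v (- 1 \<cdot>\<^sub>v c)"
    using mult_mat_vec[OF boundary_carrier(2)[OF cc] c(1)] c boundary_carrier(2)[OF cc, of k]
    by (auto intro!: eq_vecI)
  then show ?thesis using c unfolding boundaries_def by auto
qed

lemma homology_class_add_boundary:
  assumes cc: "based_chain_complex n d" and z: "z \<in> carrier_vec (n k)"
    and b: "b \<in> boundaries n d k"
  shows "homology_class n d k (z + b) = homology_class n d k z"
proof -
  have car: "c \<in> carrier_vec (n k)" if "c \<in> boundaries n d k" for c
    using boundary_is_cycle[OF cc that] unfolding cycles_def by simp
  have "z + b + c = z + (b + c)" if "c \<in> boundaries n d k" for c
    using z car b that by (intro assoc_add_vec) auto
  then have "z + b + c \<in> homology_class n d k z" if "c \<in> boundaries n d k" for c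
    using boundaries_add[OF cc b that] that unfolding homology_class_def by auto
  moreover have "z + c \<in> homology_class n d k (z + b)" if c: "c \<in> boundaries n d k" for c
  proof -
    have "z + c = z + b + (- b + c)" using z car[OF b] car[OF c] by (auto intro!: eq_vecI)
    then show ?thesis
      using boundaries_add[OF cc boundaries_uminus[OF cc b] c] unfolding homology_class_def
      by auto
  qed
  ultimately show ?thesis by (auto simp: homology_class_def)
qed

lemma reductionD:
  assumes "reduction n d R U"
  shows "U k \<in> carrier_mat (n k) (n k)" "invertible_mat (U k)" "upper_triangular (U k)"
    "d k * U k = R k" "distinct_pivots (R k)"
  using assms unfolding reduction_def by auto

lemma reduced_boundary_carrier:
  assumes "based_chain_complex n d" "reduction n d R U"
  shows "R k \<in> carrier_mat (dim_row (d k)) (n k)" "R (Suc k) \<in> carrier_mat (n k) (n (Suc k))"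
  using reductionD(4)[OF assms(2), symmetric] reductionD(1)[OF assms(2)]
    boundary_carrier[OF assms(1)] by (metis mult_carrier_mat)+

text \<open>
  The loop clears the pivots of \<open>H = U\<inverse> R\<^sub>k\<^sub>+\<^sub>1\<close>, but \<open>\<I>\<^sub>k\<close> is defined by the pivots of
  \<open>R\<^sub>k\<^sub>+\<^sub>1\<close>: upper triangularity of \<open>U\<close> makes the two fit together.
\<close>

lemma boundary_in_reduced_coordinates:
  fixes d R U :: "nat \<Rightarrow> 'a::field mat"
  assumes cc: "based_chain_complex n d" and red: "reduction n d R U"
    and H: "H = the (mat_inverse (U k)) * R (Suc k)"
  shows "H \<in> carrier_mat (n k) (n (Suc k))" "U k * H = R (Suc k)"
    "is_pivot_of_col H p q \<longleftrightarrow> is_pivot_of_col (R (Suc k)) p q"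
proof -
  note U = reductionD(1)[OF red, of k] and R = reduced_boundary_carrier(2)[OF cc red, of k]
  note V = mat_inverse_of_invertible[OF U reductionD(2)[OF red]]
  show Hc: "H \<in> carrier_mat (n k) (n (Suc k))" using V R H by auto
  show UH: "U k * H = R (Suc k)"
    using assoc_mult_mat[OF U V(1) R] V(2) R H by simp
  show "is_pivot_of_col H p q \<longleftrightarrow> is_pivot_of_col (R (Suc k)) p q"
    using is_pivot_of_col_upper_triangular_mult[OF U reductionD(3)[OF red]
        upper_triangular_invertible_diag[OF U reductionD(2,3)[OF red]] Hc] UH by simp
qed

lemma revealing_column_is_cycle:
  assumes cc: "based_chain_complex n d" and red: "reduction n d R U"
    and i: "i \<in> revealing_indices n R k"
  shows "col (U k) i \<in> cycles n d k"
proof -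
  note U = reductionD(1)[OF red, of k]
  have i: "i < n k" and z: "is_zero_col (R k) i" using i unfolding revealing_indices_def by auto
  have "d k *\<^sub>v col (U k) i = col (R k) i"
    using col_mult2[OF boundary_carrier(1)[OF cc] U i] reductionD(4)[OF red, of k] by simp
  also have "\<dots> = 0\<^sub>v (dim_row (d k))"
    using z arg_cong[OF reductionD(4)[OF red, of k], of dim_row] unfolding is_zero_col_def by simp
  finally show ?thesis using col_dim[of "U k" i] U unfolding cycles_def by simp
qed

text \<open>
  Right multiplication by the invertible \<open>U\<^sub>k\<^sub>+\<^sub>1\<close> does not change the image.
\<close>

lemma boundaries_eq_reduced_image:
  assumes cc: "based_chain_complex n d" and red: "reduction n d R U"
  shows "boundaries n d k = (\<lambda>w. R (Suc k) *\<^sub>v w) ` carrier_vec (n (Suc k))"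
proof -
  let ?U = "U (Suc k)" and ?V = "the (mat_inverse (U (Suc k)))"
  note d = boundary_carrier(2)[OF cc, of k]
  note U = reductionD(1)[OF red, of "Suc k"]
  note V = mat_inverse_of_invertible[OF U reductionD(2)[OF red]]
  have R: "R (Suc k) *\<^sub>v w = d (Suc k) *\<^sub>v (?U *\<^sub>v w)" if "w \<in> carrier_vec (n (Suc k))" for w
    using assoc_mult_mat_vec[OF d U that] reductionD(4)[OF red, of "Suc k"] by simp
  have "d (Suc k) *\<^sub>v c = R (Suc k) *\<^sub>v (?V *\<^sub>v c)" if c: "c \<in> carrier_vec (n (Suc k))" for c
  proof -
    have "?U *\<^sub>v (?V *\<^sub>v c) = c" using assoc_mult_mat_vec[OF U V(1) c] V(2) c by simp
    then show ?thesis using R[of "?V *\<^sub>v c"] V(1) c by simp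
  qed
  moreover have "?V *\<^sub>v c \<in> carrier_vec (n (Suc k))" "?U *\<^sub>v c \<in> carrier_vec (n (Suc k))"
    if "c \<in> carrier_vec (n (Suc k))" for c using U V(1) that by auto
  ultimately show ?thesis unfolding boundaries_def using R
    by (intro subset_antisym image_subsetI) (metis imageI)+
qed

text \<open>
  Since \<open>R\<^sub>k w = \<partial>\<^sub>k (U\<^sub>k w)\<close>, coordinates of cycles lie in the kernel of \<open>R\<^sub>k\<close>.
\<close>

lemma cycle_coordinates_zero:
  assumes cc: "based_chain_complex n d" and red: "reduction n d R U"
    and w: "w \<in> carrier_vec (n k)" and cyc: "U k *\<^sub>v w \<in> cycles n d k"
    and j: "j < n k" "\<not> is_zero_col (R k) j"
  shows "w $ j = 0"
proof (rule kernel_zero_at_nonzero_col[OF _ reductionD(5)[OF red] w _ j])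
  note d = boundary_carrier(1)[OF cc, of k] and U = reductionD(1)[OF red, of k]
  show "R k \<in> carrier_mat (dim_row (d k)) (n k)" by (rule reduced_boundary_carrier[OF cc red])
  have "R k *\<^sub>v w = d k *\<^sub>v (U k *\<^sub>v w)"
    using assoc_mult_mat_vec[OF d U w] reductionD(4)[OF red, of k] by simp
  then show "R k *\<^sub>v w = 0\<^sub>v (dim_row (d k))" using cyc unfolding cycles_def by simp
qed

lemma preferred_representativeI:
  fixes d :: "nat \<Rightarrow> 'a::field mat"
  assumes cc: "based_chain_complex n d" and red: "reduction n d R U"
    and y: "y \<in> carrier_vec (n k)" and cyc: "U k *\<^sub>v y \<in> cycles n d k"
    and supp: "\<forall>j < n k. y $ j \<noteq> 0 \<longrightarrow> j \<in> revealing_indices n R k"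
  shows "preferred_representative n d k (U k) (revealing_indices n R k)
    (homology_class n d k (U k *\<^sub>v y)) (U k *\<^sub>v y)"
proof -
  let ?I = "revealing_indices n R k" and ?h = "homology_class n d k (U k *\<^sub>v y)"
  let ?m = "n (Suc k)" and ?V = "the (mat_inverse (U k))"
  note U = reductionD(1)[OF red, of k]
  note V = mat_inverse_of_invertible[OF U reductionD(2)[OF red]]
  have I: "?I \<subseteq> {..<n k}" by (auto simp: revealing_indices_def)
  let ?N = "{U k *\<^sub>v w |w. w \<in> carrier_vec (n k) \<and> (\<forall>j < n k. w $ j \<noteq> 0 \<longrightarrow> j \<in> ?I)}"
  have mem: "U k *\<^sub>v y \<in> ?N" using y supp by blast
  have zero: "0\<^sub>v (n k) \<in> boundaries n d k"
    using boundary_carrier(2)[OF cc, of k] unfolding boundaries_def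
    by (auto intro!: image_eqI[of _ _ "0\<^sub>v ?m"])
  have "U k *\<^sub>v y = U k *\<^sub>v y + 0\<^sub>v (n k)" using U y by simp
  then have self: "U k *\<^sub>v y \<in> ?h" using zero unfolding homology_class_def by blast
  have uniq: "z = U k *\<^sub>v y" if z: "z \<in> ?h" "z \<in> ?N" for z
  proof -
    obtain w where w: "z = U k *\<^sub>v w" "w \<in> carrier_vec (n k)"
      "\<forall>j < n k. w $ j \<noteq> 0 \<longrightarrow> j \<in> ?I" using z by blast
    obtain c where c: "c \<in> carrier_vec ?m" "z = U k *\<^sub>v y + R (Suc k) *\<^sub>v c"
      using z unfolding homology_class_def boundaries_eq_reduced_image[OF cc red] by blast
    \<comment> \<open>The coordinates \<open>w\<close> and \<open>y\<close> differ by \<open>H c\<close>, and both vanish at the pivots of \<open>H\<close>.\<close>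
    let ?H = "?V * R (Suc k)"
    note H = boundary_in_reduced_coordinates(1)[OF cc red refl, of k]
      and UH = boundary_in_reduced_coordinates(2)[OF cc red refl, of k]
      and piv = boundary_in_reduced_coordinates(3)[OF cc red refl, of k]
    have dist: "distinct_pivots ?H"
      using reductionD(5)[OF red, of "Suc k"] unfolding distinct_pivots_iff piv .
    have Rc: "R (Suc k) *\<^sub>v c = U k *\<^sub>v (?H *\<^sub>v c)"
      using assoc_mult_mat_vec[OF U H c(1)] UH by simp
    have Hc: "?H *\<^sub>v c \<in> carrier_vec (n k)" using H c by auto
    have "U k *\<^sub>v w = U k *\<^sub>v (y + ?H *\<^sub>v c)"
      using mult_add_distrib_mat_vec[OF U y Hc] w c Rc by simp
    then have "?V *\<^sub>v (U k *\<^sub>v w) = ?V *\<^sub>v (U k *\<^sub>v (y + ?H *\<^sub>v c))" by simp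
    moreover have "?V *\<^sub>v (U k *\<^sub>v v) = v" if "v \<in> carrier_vec (n k)" for v
      using assoc_mult_mat_vec[OF V(1) U that] V(3) that by simp
    ultimately have wy: "w = y + ?H *\<^sub>v c" using w y Hc by simp
    have "(?H *\<^sub>v c) $ p = 0" if p: "is_pivot_of_col ?H p q" for p q
    proof -
      have pn: "p < n k" using p H by (auto simp: is_pivot_of_col_iff)
      have "p \<notin> ?I" using p unfolding piv revealing_indices_def by blast
      then have "y $ p = 0" "w $ p = 0" using supp w pn by blast+
      then show ?thesis
        using arg_cong[OF wy, of "\<lambda>v. v $ p"] pn y Hc carrier_vecD[OF Hc]
        by (simp del: dim_mult_mat_vec index_mult_mat_vec)
    qed
    then have "?H *\<^sub>v c = 0\<^sub>v (n k)" by (rule image_zero_at_pivots[OF H dist c(1)])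
    then show ?thesis using wy w y by simp
  qed
  have "?h \<inter> ?N = {U k *\<^sub>v y}" using self mem uniq by blast
  moreover have "?h \<in> homology n d k" using cyc unfolding homology_def by blast
  ultimately show ?thesis
    unfolding preferred_representative_def span_cols_eq_image_supported[OF U I] by blast
qed

section \<open>The induced-map algorithm computes preferred representatives\<close>

theorem proposition2:
  fixes nC nD :: "nat \<Rightarrow> nat"
    and dC dD RC UC RD UD F :: "nat \<Rightarrow> 'a::field mat"
    and x y :: "'a vec"
    and k i :: nat
  assumes "based_chain_complex nC dC"
    and "based_chain_complex nD dD"
    and "chain_map nC dC nD dD F"
    and "reduction nC dC RC UC"
    and "reduction nD dD RD UD"
    and "i \<in> revealing_indices nC RC k"
    and "x = col (UC k) i"
    and "y = induced_map_loop (UD k) (RD (Suc k)) (F k) x"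
  shows "y \<in> carrier_vec (nD k) \<and>
    homology_class nD dD k (UD k *\<^sub>v y) = homology_class nD dD k (F k *\<^sub>v x) \<and>
    preferred_representative nD dD k (UD k) (revealing_indices nD RD k)
      (homology_class nD dD k (UD k *\<^sub>v y)) (UD k *\<^sub>v y) \<and>
    (\<forall>j < nD k. y $ j \<noteq> 0 \<longrightarrow> j \<in> revealing_indices nD RD k)"
proof -
  note C = assms(1) and D = assms(2) and red = assms(5)
  let ?n = "nD k" and ?m = "nD (Suc k)" and ?U = "UD k" and ?V = "the (mat_inverse (UD k))"
    and ?R = "RD (Suc k)"
  let ?H = "?V * ?R" and ?y0 = "?V *\<^sub>v (F k *\<^sub>v x)"
  note U = reductionD(1)[OF red, of k]
  note V = mat_inverse_of_invertible[OF U reductionD(2)[OF red]]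
  note H = boundary_in_reduced_coordinates(1)[OF D red refl, of k]
    and UH = boundary_in_reduced_coordinates(2)[OF D red refl, of k]
    and piv = boundary_in_reduced_coordinates(3)[OF D red refl, of k]
  have Fx: "F k *\<^sub>v x \<in> cycles nD dD k"
    using chain_map_cycle[OF C D assms(3) revealing_column_is_cycle[OF C assms(4,6)]] assms(7)
    by simp
  then have Fxc: "F k *\<^sub>v x \<in> carrier_vec ?n" unfolding cycles_def by simp
  have y0: "?y0 \<in> carrier_vec ?n" using V(1) Fxc by auto
  have y: "y = fold (loop_step ?H) (rev [0..<?n]) ?y0"
    using assms(8) U unfolding induced_map_loop_def Let_def by simp
  \<comment> \<open>Pivots are smaller than the number of rows, so the loop starts with no pivot to be cleared already.\<close>
  have "\<forall>p c. is_pivot_of_col ?H p c \<longrightarrow> ?n \<le> p \<longrightarrow> ?y0 $ p = 0"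
    using H by (auto simp: is_pivot_of_col_iff)
  note loop = fold_loop_step[OF H y0 order_refl this, folded y]
  then obtain w where w: "w \<in> carrier_vec ?m" "y = ?y0 + ?H *\<^sub>v w" by blast
  have Hw: "?H *\<^sub>v w \<in> carrier_vec ?n" using H w by auto
  have yc: "y \<in> carrier_vec ?n" using w y0 Hw by auto
  have "?U *\<^sub>v y = ?U *\<^sub>v ?y0 + ?U *\<^sub>v (?H *\<^sub>v w)"
    using mult_add_distrib_mat_vec[OF U y0 Hw] w by simp
  also have "?U *\<^sub>v ?y0 = F k *\<^sub>v x" using assoc_mult_mat_vec[OF U V(1) Fxc] V(2) Fxc by simp
  also have "?U *\<^sub>v (?H *\<^sub>v w) = ?R *\<^sub>v w" using assoc_mult_mat_vec[OF U H w(1)] UH by simp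
  finally have Uy: "?U *\<^sub>v y = F k *\<^sub>v x + ?R *\<^sub>v w" .
  have b: "?R *\<^sub>v w \<in> boundaries nD dD k"
    using w unfolding boundaries_eq_reduced_image[OF D red] by blast
  have cyc: "?U *\<^sub>v y \<in> cycles nD dD k"
    unfolding Uy by (rule cycles_add[OF D Fx boundary_is_cycle[OF D b]])
  have supp: "\<forall>j < ?n. y $ j \<noteq> 0 \<longrightarrow> j \<in> revealing_indices nD RD k"
  proof (intro allI impI)
    fix j assume j: "j < ?n" "y $ j \<noteq> 0"
    have "is_zero_col (RD k) j" using cycle_coordinates_zero[OF D red yc cyc] j by blast
    moreover have "\<not> (\<exists>c. is_pivot_of_col ?R j c)" using loop j unfolding piv by blast
    ultimately show "j \<in> revealing_indices nD RD k" using j by (simp add: revealing_indices_def)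
  qed
  show ?thesis
    using yc homology_class_add_boundary[OF D Fxc b, folded Uy]
      preferred_representativeI[OF D red yc cyc supp] supp by blast
qed

end
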